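(* Let $q$ be any prime power. Then there exist a set $\mathcal{S}$ of $2$-dimensional subspaces of $\mathbb{F}_q^6$ and a set $\mathcal{R}$ of distinct $3$-dimensional subspaces of $\mathbb{F}_q^6$ such that: (i) $\mathcal{S}$ is a $1$-spread of $\mathbb{F}_q^6$, i.e. every nonzero vector of $\mathbb{F}_q^6$ lies in exactly one member of $\mathcal{S}$ (equivalently, $\mathcal{S}$ is a $q$-Steiner system $S_q(1,2,6)$, a derived $q$-Fano plane); and (ii) every $2$-dimensional subspace of $\mathbb{F}_q^6$ that does not belong to $\mathcal{S}$ is contained in exactly $q^2$ members of $\mathcal{R}$ (i.e. $\mathcal{R}$ is a residual $q$-Fano plane).
   Context: $\mathbb{F}_q$ denotes the finite field with $q$ elements. A $q$-Steiner system $S_q(t,k,n)$ is a set of $k$-dimensional subspaces of $\mathbb{F}_q^n$ such that each $t$-dimensional subspace of $\mathbb{F}_q^n$ is contained in exactly one of them; the $q$-Fano plane is $S_q(2,3,7)$. A derived $q$-Fano plane is an $S_q(1,2,6)$, and given one such system $\mathcal{S}$, a residual $q$-Fano plane is a set of distinct $3$-subspaces of $\mathbb{F}_q^6$ in which each $2$-subspace of $\mathbb{F}_q^6$ not in $\mathcal{S}$ is contained in exactly $q^2$ members. The paper proves this by an explicit construction; the statement here records the properties of the constructed pair. *)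

theory Defs
  imports "HOL-Analysis.Cartesian_Space" "HOL-Library.Numeral_Type" "HOL-Number_Theory.Prime_Powers"
begin

definition subspaces_of_dim :: "nat \<Rightarrow> ('a::field ^ 'n) set set" where
  "subspaces_of_dim k = {U. vec.subspace U \<and> vec.dim U = k}"

definition q_steiner_system :: "nat \<Rightarrow> nat \<Rightarrow> ('a::field ^ 'n) set set \<Rightarrow> bool" where
  "q_steiner_system t k S \<longleftrightarrow>
     S \<subseteq> subspaces_of_dim k \<and> (\<forall>T \<in> subspaces_of_dim t. \<exists>!U. U \<in> S \<and> T \<subseteq> U)"

text \<open>The dimension in the name is projective: the members are projective lines, that is,
  vector subspaces of dimension 2.\<close>

definition one_spread :: "('a::field ^ 'n) set set \<Rightarrow> bool" where
  "one_spread S \<longleftrightarrow>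
     S \<subseteq> subspaces_of_dim 2 \<and> (\<forall>v. v \<noteq> 0 \<longrightarrow> (\<exists>!U. U \<in> S \<and> v \<in> U))"

abbreviation derived_q_Fano_plane :: "('a::field ^ 6) set set \<Rightarrow> bool" where
  "derived_q_Fano_plane S \<equiv> q_steiner_system 1 2 S"

text \<open>Here \<open>S\<close> is meant to be a derived plane, and the order \<open>q\<close> of the field
  is \<open>CARD('a)\<close>. The blocks are distinct because \<open>R\<close> is a set.\<close>

definition residual_q_Fano_plane ::
    "('a::{field,finite} ^ 6) set set \<Rightarrow> ('a ^ 6) set set \<Rightarrow> bool" where
  "residual_q_Fano_plane S R \<longleftrightarrow>
     R \<subseteq> subspaces_of_dim 3 \<and>
     (\<forall>L \<in> subspaces_of_dim 2. L \<notin> S \<longrightarrow> card {W \<in> R. L \<subseteq> W} = CARD('a) ^ 2)"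

lemma subspaces_of_dim_1:
  "subspaces_of_dim 1 = {vec.span {v} | v :: 'a::field ^ 'n. v \<noteq> 0}"
proof (intro set_eqI iffI)
  fix T :: "('a ^ 'n) set"
  assume T: "T \<in> subspaces_of_dim 1"
  obtain B where B: "B \<subseteq> T" "vec.independent B" "T \<subseteq> vec.span B" "card B = vec.dim T"
    by (rule vec.basis_exists[of T])
  have "card B = 1" using T B(4) by (simp add: subspaces_of_dim_def)
  then obtain v where v: "B = {v}" by (auto simp: card_1_singleton_iff)
  have "T = vec.span {v}"
    using vec.span_subspace[of B T] B(1,3) T v by (simp add: subspaces_of_dim_def)
  moreover have "v \<noteq> 0" using B(2) v vec.dependent_zero by blast
  ultimately show "T \<in> {vec.span {v} | v. v \<noteq> 0}" by blast
next
  fix T :: "('a ^ 'n) set"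
  assume "T \<in> {vec.span {v} | v. v \<noteq> 0}"
  then obtain v where v: "v \<noteq> 0" "T = vec.span {v}" by blast
  have "vec.independent {v}" using v by simp
  then have "vec.dim T = 1" by (simp add: v vec.dim_eq_card_independent)
  then show "T \<in> subspaces_of_dim 1" by (simp add: subspaces_of_dim_def v)
qed

lemma one_spread_iff_q_steiner_system:
  "one_spread (S :: ('a::field ^ 'n) set set) \<longleftrightarrow> q_steiner_system 1 2 S"
proof -
  have sub: "vec.span {v} \<subseteq> U \<longleftrightarrow> v \<in> U" if "S \<subseteq> subspaces_of_dim 2" "U \<in> S" for U v
  proof -
    have "vec.subspace U" using that by (auto simp: subspaces_of_dim_def)
    then show ?thesis using vec.span_minimal[of "{v}" U] vec.span_base[of v "{v}"] by auto
  qed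
  have "(U \<in> S \<and> vec.span {v} \<subseteq> U) = (U \<in> S \<and> v \<in> U)"
    if "S \<subseteq> subspaces_of_dim 2" for U v
    using sub[OF that] by (rule conj_cong[OF refl])
  moreover have "(\<forall>T \<in> {vec.span {v} | v :: 'a ^ 'n. v \<noteq> 0}. P T) \<longleftrightarrow> (\<forall>v. v \<noteq> 0 \<longrightarrow> P (vec.span {v}))"
    for P
    by auto
  ultimately show ?thesis
    unfolding one_spread_def q_steiner_system_def subspaces_of_dim_1 by (simp cong: conj_cong)
qed

end

theory Submission
  imports Defs
begin

text \<open>Let \<open>K\<close> be the quadratic extension of \<open>F = GF(q)\<close> and view \<open>F\<^sup>6\<close> as \<open>K\<^sup>3\<close>.
  Take for \<open>S\<close> the \<open>K\<close>-lines and for \<open>R\<close> the 3-subspaces on which the determinant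
  of \<open>K\<^sup>3\<close> takes values in \<open>F\<close> and is not identically zero. If \<open>L\<close> has basis \<open>u, v\<close> and is not a
  \<open>K\<close>-line, then \<open>f = det(u, v, _)\<close> is a nonzero \<open>K\<close>-linear form, and the members of \<open>R\<close> above
  \<open>L\<close> are the spaces spanned by \<open>L\<close> and a vector \<open>w\<close> with \<open>f w \<in> F - {0}\<close>. There are
  \<open>(q - 1) q\<^sup>4\<close> such \<open>w\<close>, and each block contains \<open>q\<^sup>3 - q\<^sup>2\<close> of them.\<close>

section \<open>The quadratic extension of a finite field\<close>

text \<open>The map takes the value 0 at both 0 and 1, so on a finite field it is not injective and
  hence not surjective. Unlike the search for a non-square, this also works in characteristic
  2.\<close>

lemma ex_irreducible_Artin_Schreier:
  "\<exists>c :: 'a::{field,finite}. \<forall>x. x * x - x \<noteq> c"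
proof (rule ccontr)
  assume "\<not> ?thesis"
  then have "surj (\<lambda>x::'a. x * x - x)" unfolding surj_def by metis
  then have "inj (\<lambda>x::'a. x * x - x)" by (simp add: finite_UNIV_surj_inj)
  from injD[OF this, of 0 1] show False by simp
qed

definition quad_const :: "'a::{field,finite}" where
  "quad_const = (SOME c. \<forall>x. x * x - x \<noteq> c)"

lemma quad_const: "x * x - x \<noteq> quad_const"
  using someI_ex[OF ex_irreducible_Artin_Schreier] unfolding quad_const_def by blast

text \<open>\<open>Quad a b\<close> stands for \<open>a + b \<omega>\<close>, where \<open>\<omega>\<^sup>2 = \<omega> + quad_const\<close>.\<close>

datatype 'a quad = Quad (qre: 'a) (qim: 'a)

lemma UNIV_quad: "(UNIV :: 'a quad set) = (\<lambda>(a, b). Quad a b) ` UNIV"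
  by (auto simp: image_def intro: quad.exhaust)

lemma inj_Quad: "inj (\<lambda>(a, b). Quad a b)"
  by (auto simp: inj_def)

instance quad :: (finite) finite
  by standard (simp add: UNIV_quad)

lemma card_quad: "CARD('a::finite quad) = CARD('a) ^ 2"
  unfolding UNIV_quad card_image[OF inj_Quad]
  by (simp add: power2_eq_square card_cartesian_product flip: UNIV_Times_UNIV)

text \<open>The norm from K to F of \<open>a + b \<omega>\<close>; the conjugate of
  \<open>\<omega>\<close> is \<open>1 - \<omega>\<close>.\<close>

definition quad_norm :: "'a::{field,finite} \<Rightarrow> 'a \<Rightarrow> 'a" where
  "quad_norm a b = a * a + a * b - quad_const * b * b"

text \<open>A zero with \<open>b \<noteq> 0\<close> would make \<open>- a / b\<close> a root of the
  irreducible \<open>X^2 - X - quad_const\<close>.\<close>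

lemma quad_norm_eq_0_iff: "quad_norm a b = 0 \<longleftrightarrow> a = 0 \<and> b = 0"
proof
  assume N: "quad_norm a b = 0"
  have "b = 0"
  proof (rule ccontr)
    assume "b \<noteq> 0"
    then have "(- a / b) * (- a / b) - (- a / b) = quad_const"
      using N by (simp add: quad_norm_def field_simps)
    then show False using quad_const by blast
  qed
  then show "a = 0 \<and> b = 0" using N by (simp add: quad_norm_def)
qed (simp add: quad_norm_def)

instantiation quad :: ("{field,finite}") field
begin

definition "0 = Quad 0 0"
definition "1 = Quad 1 0"
definition "x + y = Quad (qre x + qre y) (qim x + qim y)"
definition "x - y = Quad (qre x - qre y) (qim x - qim y)"
definition "- x = Quad (- qre x) (- qim x)"
definition "x * y = Quad (qre x * qre y + quad_const * qim x * qim y)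
                         (qre x * qim y + qim x * qre y + qim x * qim y)"
text \<open>The conjugate divided by the norm. At 0 the division by zero yields 0, as the field
  class demands.\<close>

definition "inverse x = Quad ((qre x + qim x) / quad_norm (qre x) (qim x))
                             (- qim x / quad_norm (qre x) (qim x))"
definition "x div y = x * inverse (y :: 'a quad)"

lemmas quad_defs = zero_quad_def one_quad_def plus_quad_def minus_quad_def uminus_quad_def
  times_quad_def inverse_quad_def divide_quad_def

instance
proof
  fix x y z :: "'a quad"
  show "inverse x * x = 1" if "x \<noteq> 0"
  proof -
    obtain a b where x: "x = Quad a b" by (cases x)
    then have N: "quad_norm a b \<noteq> 0" using that by (simp add: quad_norm_eq_0_iff quad_defs)
    have "(a + b) * a - quad_const * b * b = quad_norm a b" "(a + b) * b - b * a - b * b = 0"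
      by (simp_all add: quad_norm_def algebra_simps)
    with N show ?thesis
      by (simp add: x quad_defs flip: add_divide_distrib diff_divide_distrib)
  qed
qed (auto simp: quad_defs quad.expand algebra_simps quad_norm_def)

end

lemma Quad_0_simps:
  "Quad a 0 + Quad b 0 = Quad (a + b) 0" "Quad a 0 - Quad b 0 = Quad (a - b) 0"
  "Quad a 0 * Quad b 0 = Quad (a * b) 0"
  by (simp_all add: quad_defs)

lemma qim_mult_real: "qim (Quad a 0 * x) = a * qim x"
  by (simp add: times_quad_def)

section \<open>Subspaces over a finite field\<close>

text \<open>Each vector of the enlarged span is uniquely \<open>k *s b + x\<close> with
  \<open>x\<close> in the old span, so every new basis vector multiplies the size by q.\<close>

lemma card_span_independent:
  fixes B :: "('a::{field,finite} ^ 'n::finite) set"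
  assumes "finite B" "vec.independent B"
  shows "card (vec.span B) = CARD('a) ^ card B"
  using assms
proof (induction B)
  case (insert b B)
  have b: "b \<notin> vec.span B" and B: "vec.independent B"
    using insert.prems insert.hyps by (auto simp: vec.independent_insert)
  define f where "f = (\<lambda>(k, x). k *s b + x)"
  have "vec.span (insert b B) = f ` (UNIV \<times> vec.span B)"
  proof (intro equalityI subsetI)
    fix x assume "x \<in> vec.span (insert b B)"
    then obtain k where "x - k *s b \<in> vec.span B" by (auto simp: vec.span_insert)
    then show "x \<in> f ` (UNIV \<times> vec.span B)"
      by (intro image_eqI[of _ _ "(k, x - k *s b)"]) (auto simp: f_def)
  next
    fix x assume "x \<in> f ` (UNIV \<times> vec.span B)"
    then obtain k y where "x = k *s b + y" "y \<in> vec.span B" by (auto simp: f_def)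
    then have "x - k *s b \<in> vec.span B" by simp
    then show "x \<in> vec.span (insert b B)" by (auto simp: vec.span_insert)
  qed
  moreover have "inj_on f (UNIV \<times> vec.span B)"
  proof (rule inj_onI, clarify)
    fix k x l y
    assume x: "x \<in> vec.span B" and y: "y \<in> vec.span B" and "f (k, x) = f (l, y)"
    then have eq: "(k - l) *s b = y - x"
      by (simp add: f_def vec.scale_left_diff_distrib algebra_simps)
    have "k = l"
    proof (rule ccontr)
      assume "k \<noteq> l"
      have "inverse (k - l) *s ((k - l) *s b) \<in> vec.span B"
        unfolding eq by (intro vec.span_scale vec.span_diff x y)
      with b \<open>k \<noteq> l\<close> show False by simp
    qed
    with eq show "k = l \<and> x = y" by simp
  qed
  ultimately show ?case
    using insert.IH[OF B] insert.hyps by (simp add: card_image card_cartesian_product)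
qed simp

lemma card_subspace:
  fixes U :: "('a::{field,finite} ^ 'n::finite) set"
  assumes "vec.subspace U"
  shows "card U = CARD('a) ^ vec.dim U"
proof -
  obtain B where B: "B \<subseteq> U" "vec.independent B" "U \<subseteq> vec.span B" "card B = vec.dim U"
    by (rule vec.basis_exists[of U])
  have "vec.span B = U" using B assms by (simp add: vec.span_subspace)
  then show ?thesis
    using card_span_independent[OF vec.finiteI_independent[OF B(2)] B(2)] B(4) by simp
qed

lemma CARD_field_gt_1: "CARD('a::{field,finite}) > 1"
proof -
  have "card {0, 1 :: 'a} \<le> CARD('a)" by (rule card_mono) auto
  then show ?thesis by simp
qed

text \<open>As q > 1, the size of a subspace determines its dimension; dimensions over F can then be
  found by counting.\<close>

lemma subspaces_of_dim_eq_card: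
  "subspaces_of_dim k = {U :: ('a::{field,finite} ^ 'n::finite) set. vec.subspace U \<and> card U = CARD('a) ^ k}"
  by (auto simp: subspaces_of_dim_def card_subspace power_inject_exp[OF CARD_field_gt_1])

section \<open>The determinant form on triples of vectors\<close>

definition det3 :: "'k::comm_ring_1 ^ 3 \<Rightarrow> 'k ^ 3 \<Rightarrow> 'k ^ 3 \<Rightarrow> 'k" where
  "det3 u v w = u$1 * (v$2 * w$3 - v$3 * w$2) - u$2 * (v$1 * w$3 - v$3 * w$1)
              + u$3 * (v$1 * w$2 - v$2 * w$1)"

lemma det3_add: "det3 u v (w + w') = det3 u v w + det3 u v w'"
  and det3_scale: "det3 u v (k *s w) = k * det3 u v w"
  and det3_left: "det3 u v u = 0"
  by (simp_all add: det3_def algebra_simps)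

text \<open>Multiplicativity of the determinant: the bracket is the determinant of the coefficient
  matrix.\<close>

lemma det3_combination:
  fixes u v w :: "'k::comm_ring_1 ^ 3"
  shows "det3 (a1 *s u + b1 *s v + c1 *s w) (a2 *s u + b2 *s v + c2 *s w) (a3 *s u + b3 *s v + c3 *s w)
    = (a1 * (b2 * c3 - b3 * c2) - a2 * (b1 * c3 - b3 * c1) + a3 * (b1 * c2 - b2 * c1)) * det3 u v w"
  unfolding det3_def vector_add_component vector_smult_component by (simp add: algebra_simps)

text \<open>On unit vectors the form takes, up to sign, the 2 by 2 minors of the pair
  \<open>u\<close>, \<open>v\<close> as values. If all of them vanish, the pair has rank at most
  one.\<close>

lemma det3_eq_0_imp_parallel:
  fixes u v :: "'k::field ^ 3"
  assumes 0: "\<And>w. det3 u v w = 0" and "u \<noteq> 0"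
  shows "\<exists>k. v = k *s u"
proof -
  have "det3 u v (axis i 1) = 0" for i by (rule 0)
  from this[of 1] this[of 2] this[of 3]
  have minors: "u$2 * v$3 = u$3 * v$2" "u$1 * v$3 = u$3 * v$1" "u$1 * v$2 = u$2 * v$1"
    by (simp_all add: det3_def axis_def)
  have cross: "u$i * v$j = u$j * v$i" for i j
    using minors exhaust_3[of i] exhaust_3[of j] by auto
  obtain i where i: "u$i \<noteq> 0" using \<open>u \<noteq> 0\<close> by (auto simp: vec_eq_iff)
  have "v = (v$i / u$i) *s u"
    using i cross[of i] by (simp add: vec_eq_iff field_simps)
  then show ?thesis ..
qed

section \<open>Identifying \<open>F\<^sup>6\<close> with \<open>K\<^sup>3\<close>\<close>

text \<open>Any bijection will do; it groups the six coordinates into three pairs, one for each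
  coordinate over K.\<close>

definition idx :: "3 \<times> bool \<Rightarrow> 6" where
  "idx = (SOME h. bij h)"

lemma bij_idx: "bij idx"
proof -
  have "card (UNIV :: (3 \<times> bool) set) = card (UNIV :: 6 set)"
    by (simp add: card_cartesian_product flip: UNIV_Times_UNIV)
  then have "\<exists>h :: 3 \<times> bool \<Rightarrow> 6. bij h"
    by (intro finite_same_card_bij) auto
  then show ?thesis unfolding idx_def by (rule someI_ex)
qed

definition qvec :: "'a::{field,finite} ^ 6 \<Rightarrow> 'a quad ^ 3" where
  "qvec x = (\<chi> i. Quad (x $ idx (i, False)) (x $ idx (i, True)))"

lemma qvec_add: "qvec (x + y) = qvec x + qvec y"
  and qvec_scale: "qvec (a *s x) = Quad a 0 *s qvec x"
  by (simp_all add: qvec_def vec_eq_iff quad_defs)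

lemma bij_qvec: "bij (qvec :: 'a::{field,finite} ^ 6 \<Rightarrow> 'a quad ^ 3)"
proof (rule bijI)
  show "inj (qvec :: 'a ^ 6 \<Rightarrow> _)"
  proof (rule injI)
    fix x y :: "'a ^ 6"
    assume "qvec x = qvec y"
    then have "x $ idx (i, b) = y $ idx (i, b)" for i b
      by (cases b) (auto simp: qvec_def vec_eq_iff)
    moreover have "\<exists>i b. j = idx (i, b)" for j
      using bij_idx by (metis bij_pointE surj_pair)
    ultimately show "x = y" by (metis vec_eq_iff)
  qed
  have inv_idx: "inv idx (idx p) = p" for p using bij_idx by (simp add: bij_is_inj)
  show "surj (qvec :: 'a ^ 6 \<Rightarrow> _)"
  proof (rule surjI)
    fix y :: "'a quad ^ 3"
    show "qvec (\<chi> j. case inv idx j of (i, b) \<Rightarrow> if b then qim (y$i) else qre (y$i)) = y"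
      by (simp add: qvec_def vec_eq_iff inv_idx)
  qed
qed

lemma qvec_inv [simp]: "qvec (inv qvec y) = y"
  by (rule surj_f_inv_f[OF bij_is_surj[OF bij_qvec]])

lemma qvec_eq_iff: "qvec x = qvec y \<longleftrightarrow> x = y"
  by (rule inj_eq[OF bij_is_inj[OF bij_qvec]])

lemma qvec_0: "qvec 0 = 0"
  by (simp add: qvec_def vec_eq_iff zero_quad_def)

section \<open>The Desarguesian spread\<close>

definition quad_line :: "'a::{field,finite} ^ 6 \<Rightarrow> ('a ^ 6) set" where
  "quad_line v = {x. \<exists>k. qvec x = k *s qvec v}"

definition quad_spread :: "('a::{field,finite} ^ 6) set set" where
  "quad_spread = {quad_line v | v. v \<noteq> 0}"

lemma quad_line_in_subspaces_of_dim:
  fixes v :: "'a::{field,finite} ^ 6"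
  assumes "v \<noteq> 0"
  shows "quad_line v \<in> subspaces_of_dim 2"
proof -
  have v: "qvec v \<noteq> 0" using assms by (metis qvec_0 qvec_eq_iff)
  have "vec.subspace (quad_line v)"
  proof (rule vec.subspaceI)
    show "0 \<in> quad_line v" by (auto simp: quad_line_def qvec_0 intro: exI[of _ 0])
    show "x + y \<in> quad_line v" if "x \<in> quad_line v" "y \<in> quad_line v" for x y
      using that by (auto simp: quad_line_def qvec_add simp flip: vec.scale_left_distrib)
    show "a *s x \<in> quad_line v" if "x \<in> quad_line v" for a x
      using that by (auto simp: quad_line_def qvec_scale)
  qed
  \<comment> \<open>Scalars of K parametrise the line without repetition because
    \<open>qvec v\<close> is nonzero; K has q^2 elements, which gives dimension 2 over F.\<close>
  moreover have "bij_betw (\<lambda>k. inv qvec (k *s qvec v)) UNIV (quad_line v)"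
  proof (rule bij_betw_imageI)
    show "inj (\<lambda>k. inv qvec (k *s qvec v))"
      using v by (auto intro!: injI dest!: arg_cong[of _ _ qvec])
    show "range (\<lambda>k. inv qvec (k *s qvec v)) = quad_line v"
      by (auto simp: quad_line_def image_iff simp flip: qvec_eq_iff)
  qed
  then have "card (quad_line v) = CARD('a) ^ 2"
    using bij_betw_same_card card_quad by metis
  ultimately show ?thesis by (simp add: subspaces_of_dim_eq_card)
qed

lemma mem_quad_line_self: "v \<in> quad_line v"
  by (auto simp: quad_line_def intro: exI[of _ 1])

text \<open>The multiplier relating \<open>x\<close> to \<open>v\<close> is nonzero, hence
  invertible in K. This gives the uniqueness of the spread member through a vector.\<close>

lemma quad_line_cong:
  assumes "x \<in> quad_line v" "x \<noteq> 0"
  shows "quad_line v = quad_line x"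
proof -
  obtain k where k: "qvec x = k *s qvec v" using assms by (auto simp: quad_line_def)
  have "k \<noteq> 0" using k assms(2) by (metis qvec_0 qvec_eq_iff vec.scale_zero_left)
  then have "l *s qvec v = (l * inverse k) *s qvec x" for l by (simp add: k)
  moreover have "l *s qvec x = (l * k) *s qvec v" for l by (simp add: k)
  ultimately show ?thesis unfolding quad_line_def by metis
qed

lemma one_spread_quad_spread: "one_spread (quad_spread :: ('a::{field,finite} ^ 6) set set)"
  unfolding one_spread_def
proof (intro conjI allI impI)
  show "quad_spread \<subseteq> (subspaces_of_dim 2 :: ('a ^ 6) set set)"
    by (auto simp: quad_spread_def quad_line_in_subspaces_of_dim)
  fix v :: "'a ^ 6"
  assume "v \<noteq> 0"
  then show "\<exists>!U. U \<in> quad_spread \<and> v \<in> U"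
    by (intro ex1I[of _ "quad_line v"])
      (auto simp: quad_spread_def mem_quad_line_self dest: quad_line_cong)
qed

section \<open>The residual system\<close>

abbreviation qdet :: "'a::{field,finite} ^ 6 \<Rightarrow> 'a ^ 6 \<Rightarrow> 'a ^ 6 \<Rightarrow> 'a quad" where
  "qdet u v w \<equiv> det3 (qvec u) (qvec v) (qvec w)"

text \<open>Quantifying over all triples avoids the choice of a basis; by \<open>qdet_span\<close>,
  a single basis with nonzero determinant in F is enough.\<close>

definition det_blocks :: "('a::{field,finite} ^ 6) set set" where
  "det_blocks = {W \<in> subspaces_of_dim 3.
     (\<forall>u\<in>W. \<forall>v\<in>W. \<forall>w\<in>W. qim (qdet u v w) = 0) \<and> (\<exists>u\<in>W. \<exists>v\<in>W. \<exists>w\<in>W. qdet u v w \<noteq> 0)}"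

lemma mem_span_3:
  fixes x :: "'a::field ^ 'n::finite"
  assumes "x \<in> vec.span {u, v, w}"
  shows "\<exists>a b c. x = a *s u + b *s v + c *s w"
proof -
  obtain a b c where "x - a *s u - b *s v - c *s w = 0"
    using assms by (auto simp: vec.span_insert)
  then have "x = a *s u + b *s v + c *s w" by (simp add: algebra_simps)
  then show ?thesis by blast
qed

text \<open>The coefficients lie in F, and so does their determinant \<open>d\<close>. One spanning
  triple therefore controls the determinants of all triples in the span.\<close>

lemma qdet_span:
  assumes "x \<in> vec.span {u, v, w}" "y \<in> vec.span {u, v, w}" "z \<in> vec.span {u, v, w}"
  shows "\<exists>d. qdet x y z = Quad d 0 * qdet u v w"
proof -
  obtain a1 b1 c1 a2 b2 c2 a3 b3 c3
    where "x = a1 *s u + b1 *s v + c1 *s w" "y = a2 *s u + b2 *s v + c2 *s w"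
      "z = a3 *s u + b3 *s v + c3 *s w"
    using assms[THEN mem_span_3] by blast
  then show ?thesis
    by (auto simp: qvec_add qvec_scale det3_combination Quad_0_simps)
qed

text \<open>The form is additive and onto K, so its q^2 fibres are translates of the kernel and
  share the q^6 vectors equally.\<close>

lemma card_qdet_vimage:
  fixes u v :: "'a::{field,finite} ^ 6"
  assumes "qdet u v w0 \<noteq> 0"
  shows "card {w. qdet u v w \<in> A} = card A * CARD('a) ^ 4"
proof -
  define fib where "fib = (\<lambda>z. {w. qdet u v w = z})"
  have fib: "card (fib z) = card (fib 0)" for z
  proof -
    \<comment> \<open>By K-linearity, rescaling \<open>w0\<close> reaches every value
      \<open>z\<close>.\<close>
    define m where "m = inv qvec ((z / qdet u v w0) *s qvec w0)"
    have m: "qdet u v m = z" using assms by (simp add: m_def det3_scale)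
    have "bij_betw (\<lambda>w. w + m) (fib 0) (fib z)"
    proof (rule bij_betw_byWitness[of _ "\<lambda>w. w - m"])
      have "qdet u v (w - m) = 0" if "qdet u v w = z" for w
        using that m det3_add[of "qvec u" "qvec v" "qvec (w - m)" "qvec m"]
        by (simp flip: qvec_add)
      then show "(\<lambda>w. w - m) ` fib z \<subseteq> fib 0" by (auto simp: fib_def)
    qed (auto simp: fib_def m qvec_add det3_add)
    then show ?thesis by (simp add: bij_betw_same_card)
  qed
  have vimage: "card {w. qdet u v w \<in> A} = card A * card (fib 0)" for A
  proof -
    have "{w. qdet u v w \<in> A} = (\<Union>z\<in>A. fib z)" by (auto simp: fib_def)
    also have "card \<dots> = (\<Sum>z\<in>A. card (fib z))"
      by (rule card_UN_disjoint) (auto simp: fib_def)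
    also have "\<dots> = card A * card (fib 0)" by (subst fib) simp
    finally show ?thesis .
  qed
  \<comment> \<open>With all of K as value set, the count determines the size of the kernel.\<close>
  have "CARD('a) ^ 2 * card (fib 0) = CARD('a) ^ 6"
    using vimage[of UNIV] by (simp add: card_quad)
  also have "\<dots> = CARD('a) ^ 2 * CARD('a) ^ 4" by (simp flip: power_add)
  finally have "card (fib 0) = CARD('a) ^ 4"
    by (rule mult_left_cancel[THEN iffD1, rotated]) simp
  then show ?thesis by (simp add: vimage)
qed

lemma card_det_blocks_above:
  fixes L :: "('a::{field,finite} ^ 6) set"
  assumes L: "L \<in> subspaces_of_dim 2" and LS: "L \<notin> quad_spread"
  shows "card {W \<in> det_blocks. L \<subseteq> W} = CARD('a) ^ 2"
proof -
  let ?q = "CARD('a)"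
  have sL: "vec.subspace L" and cL: "card L = ?q ^ 2"
    using L by (auto simp: subspaces_of_dim_eq_card)
  obtain B where B: "B \<subseteq> L" "vec.independent B" "L \<subseteq> vec.span B" "card B = 2"
    using vec.basis_exists[of L] L by (auto simp: subspaces_of_dim_def)
  then obtain u v where Buv: "B = {u, v}" and uv: "u \<noteq> v" by (auto simp: card_2_iff)
  have spanL: "vec.span {u, v} = L" using B sL Buv vec.span_subspace by blast
  have u0: "u \<noteq> 0" using B(2) Buv vec.dependent_zero by auto
  have uvL: "u \<in> L" "v \<in> L" using B(1) Buv by auto

  \<comment> \<open>Otherwise \<open>v\<close> is a K-multiple of \<open>u\<close>, and
    \<open>L\<close> fills the K-line of \<open>u\<close>, which belongs to the spread.\<close>
  have "\<exists>w. qdet u v w \<noteq> 0"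
  proof (rule ccontr)
    assume "\<nexists>w. qdet u v w \<noteq> 0"
    then have "det3 (qvec u) (qvec v) y = 0" for y by (metis qvec_inv)
    then obtain k where "qvec v = k *s qvec u"
      using det3_eq_0_imp_parallel u0 by (metis qvec_0 qvec_eq_iff)
    then have "v \<in> quad_line u" by (auto simp: quad_line_def)
    then have "L \<subseteq> quad_line u"
      unfolding spanL[symmetric] using quad_line_in_subspaces_of_dim[OF u0] mem_quad_line_self
      by (intro vec.span_minimal) (auto simp: subspaces_of_dim_def)
    moreover have "card (quad_line u) = card L"
      using quad_line_in_subspaces_of_dim[OF u0] cL by (simp add: subspaces_of_dim_eq_card)
    ultimately have "L = quad_line u" by (intro card_subset_eq) auto
    then show False using LS u0 by (auto simp: quad_spread_def)
  qed
  then obtain w0 where w0: "qdet u v w0 \<noteq> 0" by blast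

  have det_L: "qdet u v w = 0" if "w \<in> L" for w
  proof -
    \<comment> \<open>Repeating \<open>u\<close> brings \<open>L\<close> into the form of
      \<open>qdet_span\<close>, with a determinant that vanishes.\<close>
    have "w \<in> vec.span {u, v, u}" using that spanL by (simp add: insert_commute)
    from qdet_span[OF _ _ this, of u v] show ?thesis
      by (auto simp: vec.span_base det3_left)
  qed

  \<comment> \<open>The vectors that extend \<open>L\<close> to a block: those at which the form has
    a nonzero value in F.\<close>
  define M where "M = {w. qdet u v w \<in> (\<lambda>a. Quad a 0) ` (- {0})}"
  have M_iff: "w \<in> M \<longleftrightarrow> qim (qdet u v w) = 0 \<and> qdet u v w \<noteq> 0" for w
    by (cases "qdet u v w") (auto simp: M_def zero_quad_def)
  have "card ((\<lambda>a::'a. Quad a 0) ` (- {0})) = ?q - 1"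
    by (subst card_image) (auto intro: inj_onI simp: Compl_eq_Diff_UNIV)
  then have cM: "card M = (?q - 1) * ?q ^ 4"
    unfolding M_def by (simp add: card_qdet_vimage[OF w0])

  let ?g = "\<lambda>w. vec.span {u, v, w}"
  have dim_g: "?g w \<in> subspaces_of_dim 3" if "w \<notin> L" for w
  proof -
    have "w \<notin> {u, v}" using that uvL by auto
    moreover have "vec.independent (insert w {u, v})"
      using that B(2) Buv spanL by (auto simp: vec.independent_insert)
    ultimately have "vec.dim (insert w {u, v}) = 3"
      using uv by (subst vec.dim_eq_card_independent) auto
    then show ?thesis by (simp add: subspaces_of_dim_def insert_commute)
  qed
  have L_g: "L \<subseteq> ?g w" for w
    unfolding spanL[symmetric] by (rule vec.span_mono) auto
  have g_block: "?g w \<in> det_blocks" if "w \<in> M" for w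
  proof -
    have w: "qim (qdet u v w) = 0" "qdet u v w \<noteq> 0" using that by (auto simp: M_iff)
    then have "qim (qdet x y z) = 0" if "x \<in> ?g w" "y \<in> ?g w" "z \<in> ?g w" for x y z
      using qdet_span[OF that] by (auto simp: qim_mult_real)
    moreover have "u \<in> ?g w" "v \<in> ?g w" "w \<in> ?g w" by (auto intro: vec.span_base)
    moreover have "w \<notin> L" using w det_L by auto
    ultimately show ?thesis unfolding det_blocks_def using dim_g w by blast
  qed
  \<comment> \<open>Conversely, any vector of a block outside \<open>L\<close> generates the block
    together with \<open>L\<close>. All determinants on the block are multiples of
    \<open>qdet u v w\<close>, and one of them is nonzero, so this one is too.\<close>
  have block: "w \<in> M" "?g w = W" if W: "W \<in> det_blocks" "L \<subseteq> W" and w: "w \<in> W" "w \<notin> L" for W w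
  proof -
    have sW: "W \<in> subspaces_of_dim 3" using W by (simp add: det_blocks_def)
    have "?g w \<subseteq> W"
      using sW w W(2) uvL by (intro vec.span_minimal) (auto simp: subspaces_of_dim_def)
    then show g: "?g w = W"
      using sW dim_g[OF w(2)] by (intro card_subset_eq) (auto simp: subspaces_of_dim_eq_card)
    obtain x y z where "x \<in> W" "y \<in> W" "z \<in> W" "qdet x y z \<noteq> 0"
      using W by (auto simp: det_blocks_def)
    with qdet_span[of x u v w y z] g have "qdet u v w \<noteq> 0" by auto
    moreover have "qim (qdet u v w) = 0"
      using W w uvL unfolding det_blocks_def by blast
    ultimately show "w \<in> M" by (simp add: M_iff)
  qed

  let ?R = "{W \<in> det_blocks. L \<subseteq> W}"
  have fibre: "{w \<in> M. ?g w = W} = W - L" if "W \<in> ?R" for W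
  proof (intro equalityI subsetI)
    fix w assume "w \<in> {w \<in> M. ?g w = W}"
    then have "w \<in> M" "?g w = W" by auto
    moreover have "w \<in> ?g w" by (rule vec.span_base) simp
    ultimately show "w \<in> W - L" using det_L M_iff by blast
  next
    fix w assume "w \<in> W - L"
    then show "w \<in> {w \<in> M. ?g w = W}" using block[of W w] that by blast
  qed
  have card_fibre: "card (W - L) = (?q - 1) * ?q ^ 2" if "W \<in> ?R" for W
  proof -
    have "card W = ?q ^ 3" using that by (auto simp: det_blocks_def subspaces_of_dim_eq_card)
    moreover have "L \<subseteq> W" using that by auto
    ultimately show ?thesis
      by (simp add: card_Diff_subset cL algebra_simps power2_eq_square power3_eq_cube)
  qed
  \<comment> \<open>Double counting: \<open>M\<close> is partitioned according to the block spanned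
    with \<open>L\<close>, and each class has (q - 1) q^2 elements.\<close>
  have "M = (\<Union>W\<in>?R. {w \<in> M. ?g w = W})" using g_block L_g by auto
  then have "card M = card (\<Union>W\<in>?R. {w \<in> M. ?g w = W})" by simp
  also have "\<dots> = (\<Sum>W\<in>?R. card {w \<in> M. ?g w = W})"
    by (rule card_UN_disjoint) auto
  also have "\<dots> = (\<Sum>W\<in>?R. (?q - 1) * ?q ^ 2)"
    by (rule sum.cong) (use fibre card_fibre in auto)
  also have "\<dots> = card ?R * ((?q - 1) * ?q ^ 2)" by simp
  finally have "card ?R * ((?q - 1) * ?q ^ 2) = (?q - 1) * ?q ^ 4" unfolding cM by (rule sym)
  also have "\<dots> = ?q ^ 2 * ((?q - 1) * ?q ^ 2)"
    by (simp add: power2_eq_square power4_eq_xxxx)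
  finally show ?thesis
    by (rule mult_right_cancel[THEN iffD1, rotated]) (use CARD_field_gt_1[where 'a='a] in simp)
qed

theorem theorem27:
  fixes q :: nat
  assumes "primepow q"
    and "CARD('a::{field,finite}) = q"
  shows "\<exists>(S :: ('a ^ 6) set set) (R :: ('a ^ 6) set set).
    one_spread S \<and> derived_q_Fano_plane S \<and> residual_q_Fano_plane S R"
proof (intro exI conjI)
  show "one_spread (quad_spread :: ('a ^ 6) set set)"
    by (rule one_spread_quad_spread)
  then show "derived_q_Fano_plane (quad_spread :: ('a ^ 6) set set)"
    by (simp add: one_spread_iff_q_steiner_system)
  show "residual_q_Fano_plane quad_spread (det_blocks :: ('a ^ 6) set set)"
    unfolding residual_q_Fano_plane_def
    by (auto simp: card_det_blocks_above) (simp add: det_blocks_def)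
qed

end
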